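(* Let $W$ denote the collection of the $D$ real weights of a model, let $p(Y \mid X, W)$ be its likelihood function for a dataset $(X,Y)$, and assume that the log-uniform prior is used for $W$, i.e. the prior factorises over the individual weights $w \in W$ with $p(w) = C/|w|$. Assume that there exists some weight $w \in W$ such that the likelihood function at $w = 0$ is continuous in $w$ and non-zero. Then the posterior is improper.
   Context: The weights $W$ are identified with a point of $\mathbb{R}^D$, and $w \in W$ means that $w$ is one of the $D$ scalar weights. The log-uniform prior $p(W) = \prod_{w \in W} C/|w|$ is equivalent to a uniform prior on $\log|w|$ for each weight; it is an improper prior (no constant $C$ makes $C/|w|$ a probability density), and $C$ is treated as a positive finite constant. The posterior has unnormalised density $p(Y \mid X, W)\,p(W)$ on $\mathbb{R}^D$. For a proper posterior the normaliser $Z = \int_{\mathbb{R}^D} p(Y \mid X, W)\, p(W)\, dW$ has to be finite; the posterior is improper when $Z = \infty$, so that it cannot be renormalised into a probability density. *)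

theory Defs
  imports "HOL-Analysis.Analysis"
begin

text \<open>
  The weights are the coordinates of \<open>W :: real ^ 'n\<close>, so \<open>D = CARD('n)\<close> and a single weight
  is given by its index in \<open>'n\<close>. The weight indexed by \<open>i\<close> is set to \<open>t\<close>, the others are kept:
\<close>

definition set_weight :: "real ^ 'n \<Rightarrow> 'n \<Rightarrow> real \<Rightarrow> real ^ 'n"
  where "set_weight W i t = (\<chi> j. if j = i then t else W $ j)"

text \<open>
  Since \<open>C / 0 = 0\<close> in HOL, the prior density below is \<open>0\<close> on the coordinate hyperplanes. These
  form a Lebesgue null set, so the choice of value there does not affect any integral.
\<close>

definition log_uniform_prior :: "real \<Rightarrow> real ^ 'n \<Rightarrow> real"
  where "log_uniform_prior C W = (\<Prod>i\<in>UNIV. C / \<bar>W $ i\<bar>)"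

definition posterior_normaliser :: "(real ^ 'n \<Rightarrow> real) \<Rightarrow> (real ^ 'n \<Rightarrow> real) \<Rightarrow> ennreal"
  where "posterior_normaliser lik prior = (\<integral>\<^sup>+ W. ennreal (lik W * prior W) \<partial>lebesgue)"

definition improper_posterior :: "(real ^ 'n \<Rightarrow> real) \<Rightarrow> (real ^ 'n \<Rightarrow> real) \<Rightarrow> bool"
  where "improper_posterior lik prior \<longleftrightarrow> posterior_normaliser lik prior = \<infinity>"

text \<open>
  ``The likelihood at \<open>w = 0\<close> is continuous in \<open>w\<close> and non-zero'', for the weight with index \<open>i\<close>:
  this is a condition on the likelihood as a function of that single weight, required for all
  values of the remaining weights. (The coordinate \<open>W $ i\<close> is irrelevant, as it is overwritten.)
\<close>

definition continuous_nonzero_at_zero_weight :: "(real ^ 'n \<Rightarrow> real) \<Rightarrow> 'n \<Rightarrow> bool"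
  where "continuous_nonzero_at_zero_weight lik i \<longleftrightarrow>
    (\<forall>W. isCont (\<lambda>t. lik (set_weight W i t)) 0 \<and> lik (set_weight W i 0) \<noteq> 0)"

end

theory Submission imports Defs
begin

text \<open>
  The improper measure with density \<open>log_uniform_prior C\<close> is invariant under rescaling a single
  weight. Hence the posterior mass of the slab where the \<open>i\<close>-th weight is smaller than \<open>s\<close> equals
  the mass of the unit slab for the likelihood with that weight multiplied by \<open>s\<close>. As \<open>s \<rightarrow> 0\<close>, the
  former tends to \<open>0\<close> if the normaliser is finite (dominated convergence), while by Fatou's lemma
  the latter stays above the integral over the unit slab of the positive function
  \<open>W \<mapsto> lik (set_weight W i 0)\<close> against the prior, which is positive.
\<close>

lemma set_weight_nth [simp]: "set_weight W i t $ j = (if j = i then t else W $ j)"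
  by (simp add: set_weight_def)

lemma borel_measurable_log_uniform_prior [measurable]:
  "(log_uniform_prior C :: real ^ 'n \<Rightarrow> real) \<in> borel_measurable borel"
  unfolding log_uniform_prior_def by measurable

lemma log_uniform_prior_nonneg: "0 \<le> C \<Longrightarrow> 0 \<le> log_uniform_prior C W"
  unfolding log_uniform_prior_def by (intro prod_nonneg) auto

lemma log_uniform_prior_eq_0_iff:
  assumes "C \<noteq> 0"
  shows "log_uniform_prior C W = 0 \<longleftrightarrow> (\<exists>i. W $ i = 0)"
  using assms unfolding log_uniform_prior_def by auto

text \<open>The density \<open>C / \<bar>w\<bar>\<close> is homogeneous of degree -1, so the
  Jacobian \<open>s\<close> cancels exactly. If \<open>W $ i = 0\<close>, both sides vanish because
  \<open>C / 0 = 0\<close>.\<close>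

lemma log_uniform_prior_scale_weight:
  assumes "0 < s"
  shows "s * log_uniform_prior C (set_weight W i (s * W $ i)) = log_uniform_prior C W"
proof -
  have "log_uniform_prior C (set_weight W i (s * W $ i)) =
      C / \<bar>s * W $ i\<bar> * (\<Prod>j\<in>UNIV - {i}. C / \<bar>W $ j\<bar>)"
    unfolding log_uniform_prior_def by (subst prod.remove[of _ i]) auto
  moreover have "log_uniform_prior C W = C / \<bar>W $ i\<bar> * (\<Prod>j\<in>UNIV - {i}. C / \<bar>W $ j\<bar>)"
    unfolding log_uniform_prior_def by (subst prod.remove[of _ i]) auto
  ultimately show ?thesis
    using assms by (simp add: abs_mult)
qed

text \<open>This puts the rescaling into the diagonal affine form, with translation
  \<open>0\<close>, to which the library facts on \<open>lebesgue\<close> apply.\<close>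

lemma set_weight_scale_eq_affine:
  fixes W :: "real ^ 'n"
  shows "set_weight W i (s * W $ i) =
    0 + (\<Sum>j\<in>Basis. ((if j = axis i 1 then s else 1) * (W \<bullet> j)) *\<^sub>R j)"
proof (rule euclidean_eqI)
  fix b :: "real ^ 'n"
  assume b: "b \<in> Basis"
  then obtain k where k: "b = axis k 1"
    by (auto simp: Basis_vec_def)
  show "set_weight W i (s * W $ i) \<bullet> b =
      (0 + (\<Sum>j\<in>Basis. ((if j = axis i 1 then s else 1) * (W \<bullet> j)) *\<^sub>R j)) \<bullet> b"
    unfolding add_0 inner_sum_left_Basis[OF b] by (simp add: k inner_axis axis_eq_axis)
qed

text \<open>With \<open>s \<noteq> 0\<close> the map is invertible and pulls null sets back to null
  sets, as the completed measure on the target side demands.\<close>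

lemma measurable_scale_weight:
  assumes "s \<noteq> 0"
  shows "(\<lambda>W :: real ^ 'n. set_weight W i (s * W $ i)) \<in> lebesgue \<rightarrow>\<^sub>M lebesgue"
  unfolding set_weight_scale_eq_affine
  by (rule lebesgue_affine_measurable) (use assms in auto)

text \<open>Change of variables for a diagonal linear map with determinant \<open>s\<close>.\<close>

lemma nn_integral_scale_weight:
  fixes f :: "real ^ 'n \<Rightarrow> ennreal"
  assumes s: "0 < s" and f: "f \<in> borel_measurable lebesgue"
  shows "(\<integral>\<^sup>+ W. f W \<partial>lebesgue) = (\<integral>\<^sup>+ W. ennreal s * f (set_weight W i (s * W $ i)) \<partial>lebesgue)"
proof -
  let ?c = "\<lambda>j :: real ^ 'n. if j = axis i 1 then s else 1"
  let ?T = "\<lambda>W :: real ^ 'n. set_weight W i (s * W $ i)"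
  have T: "?T \<in> lebesgue \<rightarrow>\<^sub>M lebesgue"
    using s by (intro measurable_scale_weight) auto
  have "axis i 1 \<in> (Basis :: (real ^ 'n) set)"
    by (simp add: axis_in_Basis_iff)
  then have "(\<Prod>j\<in>Basis. \<bar>?c j\<bar>) = s"
    using s by (subst prod.remove[of _ "axis i 1"]) auto
  then have leb: "(lebesgue :: (real ^ 'n) measure) =
      density (distr lebesgue lebesgue ?T) (\<lambda>_. ennreal s)"
    using lebesgue_affine_euclidean[of ?c 0] s
    unfolding set_weight_scale_eq_affine by simp
  have "(\<integral>\<^sup>+ W. f W \<partial>lebesgue) =
      (\<integral>\<^sup>+ W. f W \<partial>density (distr lebesgue lebesgue ?T) (\<lambda>_. ennreal s))"
    by (subst leb) simp
  also have "\<dots> = (\<integral>\<^sup>+ W. ennreal s * f W \<partial>distr lebesgue lebesgue ?T)"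
    using f by (intro nn_integral_density) auto
  also have "\<dots> = (\<integral>\<^sup>+ W. ennreal s * f (?T W) \<partial>lebesgue)"
    using f T by (intro nn_integral_distr) auto
  finally show ?thesis .
qed

text \<open>The box has volume 1. It serves below as a set of positive measure that avoids every
  coordinate hyperplane.\<close>

lemma not_AE_lebesgue_outside_unit_box:
  "\<not> (AE W :: 'a :: euclidean_space in lebesgue. W \<notin> box 0 One)"
proof
  assume "AE W :: 'a in lebesgue. W \<notin> box 0 One"
  then have "emeasure lebesgue (box 0 One :: 'a set) = 0"
    by (subst (asm) AE_iff_measurable[OF _ refl]) auto
  then show False
    by (simp add: emeasure_lborel_box_eq)
qed

text \<open>The integrable \<open>f\<close> dominates. Off the hyperplane the indicator is
  eventually \<open>0\<close>; on it the assumption \<open>zero\<close> takes over.\<close>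

lemma nn_integral_weight_slab_tendsto_0:
  fixes f :: "real ^ 'n \<Rightarrow> ennreal"
  assumes f: "f \<in> borel_measurable lebesgue" and fin: "(\<integral>\<^sup>+ W. f W \<partial>lebesgue) < \<infinity>"
    and zero: "\<And>W. W $ i = 0 \<Longrightarrow> f W = 0" and s: "s \<longlonglongrightarrow> 0"
  shows "(\<lambda>k. \<integral>\<^sup>+ W. f W * indicator {W. \<bar>W $ i\<bar> < s k} W \<partial>lebesgue) \<longlonglongrightarrow> 0"
proof -
  have [measurable]: "{W :: real ^ 'n. \<bar>W $ i\<bar> < s k} \<in> sets lebesgue" for k
    by (rule sets_completionI_sets) simp
  have lim: "(\<lambda>k. f W * indicator {W. \<bar>W $ i\<bar> < s k} W) \<longlonglongrightarrow> 0" for W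
  proof (cases "W $ i = 0")
    case False
    then have "\<forall>\<^sub>F k in sequentially. s k < \<bar>W $ i\<bar>"
      using s by (intro order_tendstoD(2)) auto
    then show ?thesis
      by (intro tendsto_eventually) (erule eventually_mono, simp)
  qed (simp add: zero)
  have "(\<lambda>k. \<integral>\<^sup>+ W. f W * indicator {W. \<bar>W $ i\<bar> < s k} W \<partial>lebesgue)
      \<longlonglongrightarrow> (\<integral>\<^sup>+ W. 0 \<partial>(lebesgue :: (real ^ 'n) measure))"
  proof (rule nn_integral_dominated_convergence)
    show "(\<lambda>W. f W * indicator {W. \<bar>W $ i\<bar> < s k} W) \<in> borel_measurable lebesgue" for k
      using f by measurable
    show "AE W in lebesgue. f W * indicator {W. \<bar>W $ i\<bar> < s k} W \<le> f W" for k
      by (rule AE_I2) (simp add: indicator_def)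
    show "AE W in lebesgue. (\<lambda>k. f W * indicator {W. \<bar>W $ i\<bar> < s k} W) \<longlonglongrightarrow> 0"
      by (rule AE_I2) (rule lim)
  qed (use f fin in simp_all)
  then show ?thesis by simp
qed

theorem proposition1:
  fixes p :: "'y \<Rightarrow> 'x \<Rightarrow> real ^ 'n \<Rightarrow> real"
    and X :: 'x and Y :: 'y and C :: real
  assumes lik_measurable: "p Y X \<in> borel_measurable lebesgue"
    and lik_nonneg: "\<And>W. 0 \<le> p Y X W"
    and C_pos: "0 < C"
    and weight: "\<exists>i. continuous_nonzero_at_zero_weight (p Y X) i"
  shows "improper_posterior (p Y X) (log_uniform_prior C)"
proof (rule ccontr)
  let ?prior = "log_uniform_prior C :: real ^ 'n \<Rightarrow> real"
  assume proper: "\<not> ?thesis"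
  obtain i where i: "continuous_nonzero_at_zero_weight (p Y X) i"
    using weight by blast
  \<comment> \<open>Any positive null sequence would do; the limit theorems for integrals used below
    are about sequences.\<close>
  define s :: "nat \<Rightarrow> real" where "s k = (1 / 2) ^ k" for k
  have s_pos: "0 < s k" for k
    by (simp add: s_def)
  have s_lim: "s \<longlonglongrightarrow> 0"
    unfolding s_def by (intro LIMSEQ_power_zero) simp
  define T where "T k W = set_weight W i (s k * W $ i)" for k W
  define B where "B r = {W :: real ^ 'n. \<bar>W $ i\<bar> < r}" for r
  define f where "f W = ennreal (p Y X W * ?prior W)" for W
  \<comment> \<open>The argument is rescaled only in the likelihood: the prior has already absorbed
    the Jacobian.\<close>
  define g where "g k W = ennreal (p Y X (T k W) * ?prior W) * indicator (B 1) W" for k W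
  define h where "h W = ennreal (p Y X (set_weight W i 0) * ?prior W) * indicator (B 1) W" for W

  have [measurable]: "?prior \<in> borel_measurable lebesgue"
    by (rule measurable_completion) simp
  have [measurable]: "B r \<in> sets lebesgue" for r
    unfolding B_def by (rule sets_completionI_sets) simp
  note [measurable] = lik_measurable
  have [measurable]: "f \<in> borel_measurable lebesgue"
    unfolding f_def by measurable
  have [measurable]: "T k \<in> lebesgue \<rightarrow>\<^sub>M lebesgue" for k
    unfolding T_def using s_pos[of k] by (intro measurable_scale_weight) auto
  have [measurable]: "g k \<in> borel_measurable lebesgue" for k
    unfolding g_def by measurable

  \<comment> \<open>Only the likelihood depends on \<open>k\<close>, and \<open>T k W\<close> moves
    along the line of the \<open>i\<close>-th weight, so continuity in that weight alone
    suffices.\<close>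
  have g_lim: "(\<lambda>k. g k W) \<longlonglongrightarrow> h W" for W
  proof -
    have "(\<lambda>k. s k * W $ i) \<longlonglongrightarrow> 0"
      using s_lim by (rule tendsto_mult_left_zero)
    moreover have "isCont (\<lambda>t. p Y X (set_weight W i t)) 0"
      using i by (auto simp: continuous_nonzero_at_zero_weight_def)
    ultimately have "(\<lambda>k. p Y X (T k W)) \<longlonglongrightarrow> p Y X (set_weight W i 0)"
      unfolding T_def by (rule isCont_tendsto_compose[rotated])
    then show ?thesis
      unfolding g_def h_def by (intro tendsto_intros) (auto simp: indicator_def)
  qed
  \<comment> \<open>Lebesgue measurability of \<open>p Y X\<close> says nothing about its values on
    the null hyperplane \<open>W $ i = 0\<close>, so \<open>h\<close> is measured as a pointwise
    limit.\<close>
  have [measurable]: "h \<in> borel_measurable lebesgue"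
    using g_lim by (rule borel_measurable_LIMSEQ_order) measurable

  have slab: "(\<integral>\<^sup>+ W. f W * indicator (B (s k)) W \<partial>lebesgue) = (\<integral>\<^sup>+ W. g k W \<partial>lebesgue)" for k
  proof -
    have "ennreal (s k) * (f (T k W) * indicator (B (s k)) (T k W)) = g k W" for W
    proof -
      have "T k W \<in> B (s k) \<longleftrightarrow> W \<in> B 1"
        using s_pos[of k] by (simp add: T_def B_def abs_mult)
      moreover have "ennreal (s k) * f (T k W) = ennreal (p Y X (T k W) * ?prior W)"
        using s_pos[of k] log_uniform_prior_scale_weight[OF s_pos, of k C W i]
        by (simp add: f_def T_def flip: ennreal_mult') (metis mult.left_commute)
      ultimately show ?thesis
        by (simp add: g_def indicator_def)
    qed
    then show ?thesis
      by (subst nn_integral_scale_weight[OF s_pos[of k], where i = i]) (auto simp: T_def)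
  qed

  have "(\<lambda>k. \<integral>\<^sup>+ W. f W * indicator (B (s k)) W \<partial>lebesgue) \<longlonglongrightarrow> 0"
    unfolding B_def
  proof (rule nn_integral_weight_slab_tendsto_0)
    show "(\<integral>\<^sup>+ W. f W \<partial>lebesgue) < \<infinity>"
      using proper
      by (simp add: improper_posterior_def posterior_normaliser_def f_def less_top)
    \<comment> \<open>Here the convention \<open>C / 0 = 0\<close> enters: the prior vanishes on the
      hyperplane.\<close>
    show "f W = 0" if "W $ i = 0" for W
    proof -
      have "?prior W = 0"
        using that C_pos log_uniform_prior_eq_0_iff[of C W] by auto
      then show ?thesis
        by (simp add: f_def)
    qed
  qed (use s_lim in auto)
  then have "liminf (\<lambda>k. \<integral>\<^sup>+ W. g k W \<partial>lebesgue) = 0"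
    unfolding slab by (intro lim_imp_Liminf) auto
  moreover have "(\<integral>\<^sup>+ W. liminf (\<lambda>k. g k W) \<partial>lebesgue) \<le> liminf (\<lambda>k. \<integral>\<^sup>+ W. g k W \<partial>lebesgue)"
    by (rule nn_integral_liminf) simp
  moreover have "liminf (\<lambda>k. g k W) = h W" for W
    using g_lim by (intro lim_imp_Liminf) auto
  ultimately have "(\<integral>\<^sup>+ W. h W \<partial>lebesgue) = 0"
    by simp
  then have "AE W in lebesgue. h W = 0"
    by (subst (asm) nn_integral_0_iff_AE) auto
  \<comment> \<open>In the box every coordinate is nonzero, so the prior is positive, and
    \<open>W $ i < 1\<close> places \<open>W\<close> in \<open>B 1\<close>.\<close>
  moreover have "h W \<noteq> 0" if "W \<in> box 0 One" for W
  proof -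
    have W: "0 < W $ j" "W $ j < 1" for j
      using that by (auto simp: mem_box_cart cart_eq_inner_axis inner_sum_left_Basis axis_in_Basis_iff)
    have "p Y X (set_weight W i 0) \<noteq> 0"
      using i by (auto simp: continuous_nonzero_at_zero_weight_def)
    then have "0 < p Y X (set_weight W i 0)"
      using lik_nonneg[of "set_weight W i 0"] by simp
    moreover have "?prior W \<noteq> 0"
      using C_pos W(1) by (auto simp: log_uniform_prior_eq_0_iff) (metis less_irrefl)
    then have "0 < ?prior W"
      using log_uniform_prior_nonneg[of C W] C_pos by simp
    ultimately show ?thesis
      using W(1)[of i] W(2)[of i] by (simp add: h_def B_def)
  qed
  ultimately have "AE W :: real ^ 'n in lebesgue. W \<notin> box 0 One"
    by (auto elim!: eventually_mono)
  then show False
    using not_AE_lebesgue_outside_unit_box by blast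
qed

end
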